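(* Let $(X,T)$ be a $\mathbb{G}$-TDS. Then $(X,T)$ is mean equicontinuous if and only if it is $f$-mean equicontinuous for every $f\in C(X)$.
   Context: $\mathbb{G}$ is a locally compact abelian group (written additively, identity $e$) with Haar measure $\nu$, and $(F_n)_{n\in\mathbb{N}}$ is a fixed Følner sequence in $\mathbb{G}$: measurable sets with $0<\nu(F_n)<\infty$ and $\nu((g+F_n)\triangle F_n)/\nu(F_n)\to 0$ for every $g\in\mathbb{G}$; it is moreover chosen to satisfy the pointwise ergodic theorem (for every ergodic measure preserving $\mathbb{G}$-action on a standard probability space $(Y,m)$ and every $h\in L^1(Y,m)$, $\frac{1}{\nu(F_n)}\int_{F_n}h(T^jy)\,d\nu(j)\to\int h\,dm$ for $m$-a.e. $y$). A $\mathbb{G}$-TDS is a pair $(X,T)$ with $X$ a compact metric space (metric $d$) and $T:\mathbb{G}\times X\to X$, $(j,x)\mapsto T^jx$, a group action (jointly Borel measurable) with each $T^j:X\to X$ continuous. $C(X)$ is the space of continuous complex-valued functions on $X$. Define $d_b(x,y)=\limsup_n\frac{1}{\nu(F_n)}\int_{F_n}d(T^jx,T^jy)\,d\nu(j)$. $(X,T)$ is mean equicontinuous if for every $x\in X$ and $\varepsilon>0$ there is $\delta>0$ such that $d(x,y)\le\delta$ implies $d_b(x,y)<\varepsilon$. For $f\in C(X)$ define $d_f(x,y)=\limsup_n\left(\frac{1}{\nu(F_n)}\int_{F_n}|f(T^jx)-f(T^jy)|^2d\nu(j)\right)^{1/2}$. $(X,T)$ is $f$-mean equicontinuous if for every $x\in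 X$ and $\varepsilon>0$ there is $\delta>0$ such that $d(x,y)\le\delta$ implies $d_f(x,y)\le\varepsilon$. *)

theory Defs
  imports "HOL-Analysis.Analysis" "HOL-Probability.Probability_Measure"
begin

text \<open>Regularity follows the Radon convention: outer regular on Borel sets, inner regular on
  open sets.\<close>

definition haar_measure :: "'g::{topological_ab_group_add, t2_space} measure \<Rightarrow> bool" where
  "haar_measure \<nu> \<longleftrightarrow>
     sets \<nu> = sets borel \<and>
     emeasure \<nu> UNIV \<noteq> 0 \<and>
     (\<forall>g. \<forall>A\<in>sets borel. emeasure \<nu> ((+) g ` A) = emeasure \<nu> A) \<and>
     (\<forall>K. compact K \<longrightarrow> emeasure \<nu> K < \<infinity>) \<and>
     (\<forall>A\<in>sets borel. emeasure \<nu> A = (INF U\<in>{U. open U \<and> A \<subseteq> U}. emeasure \<nu> U)) \<and>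
     (\<forall>U. open U \<longrightarrow> emeasure \<nu> U = (SUP K\<in>{K. compact K \<and> K \<subseteq> U}. emeasure \<nu> K))"

definition folner_sequence :: "'g::ab_group_add measure \<Rightarrow> (nat \<Rightarrow> 'g set) \<Rightarrow> bool" where
  "folner_sequence \<nu> F \<longleftrightarrow>
     (\<forall>n. F n \<in> sets \<nu> \<and> 0 < emeasure \<nu> (F n) \<and> emeasure \<nu> (F n) < \<infinity>) \<and>
     (\<forall>g. (\<lambda>n. measure \<nu> (sym_diff ((+) g ` F n) (F n)) / measure \<nu> (F n)) \<longlonglongrightarrow> 0)"

definition folner_average ::
  "'g measure \<Rightarrow> (nat \<Rightarrow> 'g set) \<Rightarrow> nat \<Rightarrow> ('g \<Rightarrow> 'b::{banach, second_countable_topology}) \<Rightarrow> 'b" where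
  "folner_average \<nu> F n h = (1 / measure \<nu> (F n)) *\<^sub>R (LINT j:F n|\<nu>. h j)"


definition standard_probability_space :: "'y measure \<Rightarrow> bool" where
  "standard_probability_space M \<longleftrightarrow>
     prob_space M \<and>
     (\<exists>\<tau>. topspace \<tau> = space M \<and> completely_metrizable_space \<tau> \<and> separable_space \<tau> \<and>
          sets M = sigma_sets (topspace \<tau>) {U. openin \<tau> U})"

definition measure_preserving_action ::
  "'y measure \<Rightarrow> ('g::{topological_ab_group_add, t2_space} \<Rightarrow> 'y \<Rightarrow> 'y) \<Rightarrow> bool" where
  "measure_preserving_action M S \<longleftrightarrow>
     (\<forall>y\<in>space M. S 0 y = y) \<and>
     (\<forall>g h. \<forall>y\<in>space M. S (g + h) y = S g (S h y)) \<and>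
     (\<lambda>(j, y). S j y) \<in> measurable (borel \<Otimes>\<^sub>M M) M \<and>
     (\<forall>g. \<forall>A\<in>sets M. emeasure M (S g -` A \<inter> space M) = emeasure M A)"

definition ergodic_action ::
  "'y measure \<Rightarrow> ('g::{topological_ab_group_add, t2_space} \<Rightarrow> 'y \<Rightarrow> 'y) \<Rightarrow> bool" where
  "ergodic_action M S \<longleftrightarrow>
     measure_preserving_action M S \<and>
     (\<forall>A\<in>sets M. (\<forall>g. S g -` A \<inter> space M = A) \<longrightarrow> measure M A = 0 \<or> measure M A = 1)"

text \<open>HOL cannot quantify over all types inside a formula, so the standard probability spaces
  range over measures on subsets of the type \<^typ>\<open>real\<close>, carrying an arbitrary Polish topology.
  Nothing is lost: a Polish space has at most the cardinality of the continuum, so its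
  structure can be transported along an injection into the reals.\<close>

definition satisfies_pointwise_ergodic_theorem ::
  "'g::{topological_ab_group_add, t2_space} measure \<Rightarrow> (nat \<Rightarrow> 'g set) \<Rightarrow> bool" where
  "satisfies_pointwise_ergodic_theorem \<nu> F \<longleftrightarrow>
     (\<forall>(M :: real measure) (S :: 'g \<Rightarrow> real \<Rightarrow> real) (h :: real \<Rightarrow> complex).
        standard_probability_space M \<longrightarrow> ergodic_action M S \<longrightarrow> integrable M h \<longrightarrow>
        (AE y in M. (\<lambda>n. folner_average \<nu> F n (\<lambda>j. h (S j y))) \<longlonglongrightarrow> (LINT z|M. h z)))"


definition G_TDS ::
  "('g::{topological_ab_group_add, t2_space} \<Rightarrow> 'x::metric_space \<Rightarrow> 'x) \<Rightarrow> bool" where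
  "G_TDS T \<longleftrightarrow>
     compact (UNIV :: 'x set) \<and>
     (\<forall>x. T 0 x = x) \<and>
     (\<forall>g h x. T (g + h) x = T g (T h x)) \<and>
     (\<lambda>(j, x). T j x) \<in> borel_measurable borel \<and>
     (\<forall>j. continuous_on UNIV (T j))"

definition d_b ::
  "'g measure \<Rightarrow> (nat \<Rightarrow> 'g set) \<Rightarrow> ('g \<Rightarrow> 'x::metric_space \<Rightarrow> 'x) \<Rightarrow> 'x \<Rightarrow> 'x \<Rightarrow> ereal" where
  "d_b \<nu> F T x y = limsup (\<lambda>n. ereal (folner_average \<nu> F n (\<lambda>j. dist (T j x) (T j y))))"

definition mean_equicontinuous ::
  "'g measure \<Rightarrow> (nat \<Rightarrow> 'g set) \<Rightarrow> ('g \<Rightarrow> 'x::metric_space \<Rightarrow> 'x) \<Rightarrow> bool" where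
  "mean_equicontinuous \<nu> F T \<longleftrightarrow>
     (\<forall>x. \<forall>\<epsilon>>0. \<exists>\<delta>>0. \<forall>y. dist x y \<le> \<delta> \<longrightarrow> d_b \<nu> F T x y < ereal \<epsilon>)"

definition d_f ::
  "'g measure \<Rightarrow> (nat \<Rightarrow> 'g set) \<Rightarrow> ('g \<Rightarrow> 'x \<Rightarrow> 'x) \<Rightarrow> ('x \<Rightarrow> complex) \<Rightarrow> 'x \<Rightarrow> 'x \<Rightarrow> ereal" where
  "d_f \<nu> F T f x y =
     limsup (\<lambda>n. ereal (sqrt (folner_average \<nu> F n (\<lambda>j. (cmod (f (T j x) - f (T j y)))\<^sup>2))))"

definition f_mean_equicontinuous ::
  "'g measure \<Rightarrow> (nat \<Rightarrow> 'g set) \<Rightarrow> ('g \<Rightarrow> 'x::metric_space \<Rightarrow> 'x) \<Rightarrow> ('x \<Rightarrow> complex) \<Rightarrow> bool" where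
  "f_mean_equicontinuous \<nu> F T f \<longleftrightarrow>
     (\<forall>x. \<forall>\<epsilon>>0. \<exists>\<delta>>0. \<forall>y. dist x y \<le> \<delta> \<longrightarrow> d_f \<nu> F T f x y \<le> ereal \<epsilon>)"

end

theory Submission
  imports Defs
begin

text \<open>On a compact space a uniformly continuous \<open>f\<close> satisfies
  \<open>|f u - f v|\<^sup>2 \<le> a + b d(u,v)\<close> with \<open>a\<close> as small as desired, and conversely, if \<open>k\<close> is a finite
  net then the functions \<open>d(\<cdot>,z)\<close> with \<open>z \<in> k\<close> satisfy
  \<open>d(u,v) \<le> a + b \<Sum>\<^sub>z |d(u,z) - d(v,z)|\<^sup>2\<close>, again with \<open>a\<close> arbitrarily small. Averaging these
  two inequalities along the orbits gives the two implications.\<close>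

section \<open>Measurability of distances along orbits\<close>

text \<open>The union over \<open>n\<close> of finite nets of radius \<open>1 / real (Suc n)\<close>
  works. Countability is what later keeps a supremum of measurable functions measurable.\<close>

lemma compact_countable_dense:
  fixes S :: "'a::metric_space set"
  assumes "compact S"
  obtains D where "countable D" "D \<subseteq> S" "\<And>x e. x \<in> S \<Longrightarrow> 0 < e \<Longrightarrow> \<exists>z\<in>D. dist x z < e"
proof -
  have "\<forall>n. \<exists>k. finite k \<and> k \<subseteq> S \<and> S \<subseteq> (\<Union>z\<in>k. ball z (1 / real (Suc n)))"
    using seq_compact_imp_totally_bounded[OF assms[unfolded compact_eq_seq_compact_metric]]
    by simp
  then obtain k where k: "\<And>n. finite (k n)" "\<And>n. k n \<subseteq> S"
      "\<And>n. S \<subseteq> (\<Union>z\<in>k n. ball z (1 / real (Suc n)))"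
    by metis
  show thesis
  proof
    show "countable (\<Union>n. k n)" using k(1) by (simp add: countable_finite)
    show "(\<Union>n. k n) \<subseteq> S" using k(2) by blast
    fix x and e :: real
    assume "x \<in> S" "0 < e"
    then obtain n where n: "1 / real (Suc n) < e"
      using nat_approx_posE by blast
    from \<open>x \<in> S\<close> k(3)[of n] obtain z where "z \<in> k n" "dist z x < 1 / real (Suc n)"
      by auto
    with n show "\<exists>z\<in>(\<Union>n. k n). dist x z < e"
      by (intro bexI[of _ z]) (auto simp: dist_commute)
  qed
qed

text \<open>The library version of this fact requires a type of class
  \<^class>\<open>second_countable_topology\<close>; here the metric is recovered from countably many of its
  sections.\<close>

lemma borel_measurable_dist_compact:
  fixes u v :: "'a \<Rightarrow> 'b::metric_space"
  assumes compact: "compact (UNIV :: 'b set)"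
    and u: "u \<in> borel_measurable M" and v: "v \<in> borel_measurable M"
  shows "(\<lambda>j. dist (u j) (v j)) \<in> borel_measurable M"
proof -
  obtain D :: "'b set" where D: "countable D" "\<And>x e. 0 < e \<Longrightarrow> \<exists>z\<in>D. dist x z < e"
    by (rule compact_countable_dense[OF compact]) auto
  have bound: "\<bar>dist x z - dist y z\<bar> \<le> dist x y" for x y z :: 'b
    using abs_dist_diff_le[of x z y] by (simp add: dist_commute)
  have bdd: "bdd_above ((\<lambda>z. \<bar>dist x z - dist y z\<bar>) ` D)" for x y :: 'b
    using bound by (intro bdd_aboveI2)
  \<comment> \<open>Every section difference is at most the distance, and a point \<open>z\<close>
    of the dense set close to \<open>x\<close> nearly attains it.\<close>
  have eq: "dist x y = (SUP z\<in>D. \<bar>dist x z - dist y z\<bar>)" for x y :: 'b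
  proof (rule antisym)
    show "dist x y \<le> (SUP z\<in>D. \<bar>dist x z - dist y z\<bar>)"
    proof (rule field_le_epsilon)
      fix e :: real assume "0 < e"
      then obtain z where z: "z \<in> D" "dist x z < e / 2"
        using D(2)[of "e / 2" x] by auto
      \<comment> \<open>Go through \<open>z\<close> and bound \<open>dist y z\<close> by
        \<open>dist x z\<close> plus the section difference; the term \<open>2 * dist x z\<close> is
        then below \<open>e\<close>.\<close>
      have "dist x y \<le> 2 * dist x z + \<bar>dist x z - dist y z\<bar>"
        using dist_triangle2[of x y z] by linarith
      also have "\<dots> \<le> e + (SUP z\<in>D. \<bar>dist x z - dist y z\<bar>)"
        using z cSUP_upper[OF z(1) bdd[of x y]] by linarith
      finally show "dist x y \<le> (SUP z\<in>D. \<bar>dist x z - dist y z\<bar>) + e" by simp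
    qed
    show "(SUP z\<in>D. \<bar>dist x z - dist y z\<bar>) \<le> dist x y"
      \<comment> \<open>The instance of \<open>D(2)\<close> provides a point of \<open>D\<close>, so
        that the supremum is over a nonempty set.\<close>
      using D(2)[of 1 x] bound by (intro cSUP_least) auto
  qed
  have dist_z: "(\<lambda>j. dist (w j) z) \<in> borel_measurable M"
    if "w \<in> borel_measurable M" for w :: "'a \<Rightarrow> 'b" and z
    by (rule borel_measurable_continuous_on[OF _ that]) (intro continuous_intros)
  have "(\<lambda>j. SUP z\<in>D. \<bar>dist (u j) z - dist (v j) z\<bar>) \<in> borel_measurable M"
    using D(1) bdd dist_z[OF u] dist_z[OF v] by (intro borel_measurable_cSUP) auto
  then show ?thesis by (simp flip: eq)
qed

text \<open>Joint measurability refers to the Borel sets of the product topology, so the section at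
  \<open>x\<close> is handled by composing with the continuous map sending \<open>j\<close> to
  \<open>(j, x)\<close>.\<close>

lemma G_TDS_orbit_measurable:
  fixes T :: "'g::{topological_ab_group_add, t2_space} \<Rightarrow> 'x::metric_space \<Rightarrow> 'x"
  assumes "G_TDS T" and "sets \<nu> = sets borel"
  shows "(\<lambda>j. T j x) \<in> borel_measurable \<nu>"
proof -
  have "(\<lambda>j. (j, x)) \<in> borel_measurable borel"
    by (intro borel_measurable_continuous_onI continuous_intros)
  moreover have "(\<lambda>(j, x). T j x) \<in> borel_measurable borel"
    using assms(1) by (simp add: G_TDS_def)
  ultimately have "(\<lambda>j. case (j, x) of (j, x) \<Rightarrow> T j x) \<in> borel_measurable borel"
    by (rule measurable_compose)
  then show ?thesis
    using assms(2) by (simp cong: measurable_cong_sets)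
qed

section \<open>Averages over the sets \<open>F n\<close>\<close>

text \<open>This transfers a pointwise affine bound to averages: integration is monotone and linear,
  and the normalisation makes the average of the constant \<open>a\<close> equal to
  \<open>a\<close>.\<close>

lemma folner_average_mono_affine:
  fixes g h :: "'g \<Rightarrow> real"
  assumes "measure \<nu> (F n) > 0"
    and g: "set_integrable \<nu> (F n) g" and h: "set_integrable \<nu> (F n) h"
    and le: "\<And>j. g j \<le> a + b * h j"
  shows "folner_average \<nu> F n g \<le> a + b * folner_average \<nu> F n h"
proof -
  have pos: "measure \<nu> (F n) > 0" by fact
  \<comment> \<open>\<open>measure\<close> takes the default value 0 on nonmeasurable sets and on
    sets of infinite measure, so positivity excludes both.\<close>
  have F: "F n \<in> sets \<nu>" "emeasure \<nu> (F n) \<noteq> \<infinity>"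
    using pos measure_notin_sets[of "F n" \<nu>] by (force, auto simp: measure_def)
  have const: "set_integrable \<nu> (F n) (\<lambda>j. a)"
    using F by (simp add: set_integrable_def top.not_eq_extremum)
  have aff: "set_integrable \<nu> (F n) (\<lambda>j. a + b * h j)"
    using const h by (intro set_integral_add set_integrable_mult_right) auto
  have "(LINT j:F n|\<nu>. g j) \<le> (LINT j:F n|\<nu>. a + b * h j)"
    using g aff le by (intro set_integral_mono) auto
  also have "\<dots> = a * measure \<nu> (F n) + b * (LINT j:F n|\<nu>. h j)"
    using const h F by (subst set_integral_add) (auto simp: set_lebesgue_integral_def)
  finally show ?thesis
    using pos by (simp add: folner_average_def field_simps)
qed

lemma folner_average_sum:
  fixes h :: "'i \<Rightarrow> 'g \<Rightarrow> real"
  assumes "\<And>i. i \<in> I \<Longrightarrow> set_integrable \<nu> (F n) (h i)"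
  shows "folner_average \<nu> F n (\<lambda>j. \<Sum>i\<in>I. h i j) = (\<Sum>i\<in>I. folner_average \<nu> F n (h i))"
proof -
  have "(LINT j:F n|\<nu>. (\<Sum>i\<in>I. h i j)) = (\<Sum>i\<in>I. LINT j:F n|\<nu>. h i j)"
    using assms unfolding set_lebesgue_integral_def set_integrable_def
    by (simp only: scaleR_sum_right Bochner_Integration.integral_sum)
  then show ?thesis
    by (simp add: folner_average_def sum_distrib_left)
qed

section \<open>Pointwise comparison of the metric with squared differences\<close>

text \<open>For points closer than \<open>\<eta>\<close>, uniform continuity leaves at most
  \<open>a\<close>. For the others the crude bound \<open>(2 * B)\<^sup>2\<close> is absorbed by the
  linear term, since \<open>dist u v / \<eta>\<close> is at least 1.\<close>

lemma uniformly_continuous_sq_le_affine_dist: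
  fixes f :: "'x::metric_space \<Rightarrow> complex"
  assumes compact: "compact (UNIV :: 'x set)" and "continuous_on UNIV f" and "0 < a"
  obtains b where "0 < b" "\<And>u v. (cmod (f u - f v))\<^sup>2 \<le> a + b * dist u v"
proof -
  have "uniformly_continuous_on UNIV f"
    using compact_uniformly_continuous assms by blast
  then obtain \<eta> where \<eta>: "0 < \<eta>" "\<And>u v. dist u v < \<eta> \<Longrightarrow> dist (f u) (f v) < sqrt a"
    using uniformly_continuous_onE[of UNIV f "sqrt a"] \<open>0 < a\<close> by (auto simp: dist_commute)
  obtain B where B: "0 < B" "\<And>u. cmod (f u) \<le> B"
    using compact_imp_bounded[OF compact_continuous_image[OF assms(2) compact]]
    by (auto simp: bounded_pos)
  show thesis
  proof
    show "0 < (2 * B)\<^sup>2 / \<eta>" using B \<eta> by simp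
    fix u v
    show "(cmod (f u - f v))\<^sup>2 \<le> a + (2 * B)\<^sup>2 / \<eta> * dist u v"
    proof (cases "dist u v < \<eta>")
      case True
      then have "(cmod (f u - f v))\<^sup>2 \<le> (sqrt a)\<^sup>2"
        using \<eta>(2)[OF True] by (intro power_mono) (auto simp: dist_norm)
      moreover have "0 \<le> (2 * B)\<^sup>2 / \<eta> * dist u v" using \<eta> by simp
      ultimately show ?thesis using \<open>0 < a\<close> by simp
    next
      case False
      have "cmod (f u - f v) \<le> 2 * B"
        using norm_triangle_ineq4[of "f u" "f v"] B(2)[of u] B(2)[of v] by linarith
      then have "(cmod (f u - f v))\<^sup>2 \<le> (2 * B)\<^sup>2" by (intro power_mono) auto
      also have "\<dots> \<le> (2 * B)\<^sup>2 / \<eta> * dist u v"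
        using False \<eta>(1) mult_left_mono[of \<eta> "dist u v" "(2 * B)\<^sup>2"] by (simp add: field_simps)
      finally show ?thesis using \<open>0 < a\<close> by simp
    qed
  qed
qed

text \<open>A net point \<open>z\<close> near \<open>u\<close> almost recovers
  \<open>dist u v\<close> from the single difference \<open>dist u z - dist v z\<close>. Young's
  inequality trades its absolute value for its square, and the sum over \<open>k\<close> removes the
  dependence of \<open>z\<close> on \<open>u\<close>.\<close>

lemma dist_le_affine_sum_sq:
  assumes compact: "compact (UNIV :: 'x::metric_space set)" and "0 < a"
  obtains k :: "'x::metric_space set" and b where "finite k" "0 < b"
    "\<And>u v. dist u v \<le> a + b * (\<Sum>z\<in>k. (dist u z - dist v z)\<^sup>2)"
proof -
  have "\<exists>k::'x set. finite k \<and> k \<subseteq> UNIV \<and> UNIV \<subseteq> (\<Union>z\<in>k. ball z (a / 4))"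
    using seq_compact_imp_totally_bounded[OF compact[unfolded compact_eq_seq_compact_metric]]
      \<open>0 < a\<close> by simp
  then obtain k :: "'x set" where k: "finite k" "\<And>u. \<exists>z\<in>k. dist z u < a / 4"
    by (auto simp: subset_iff)
  show thesis
  proof
    show "finite k" "0 < 1 / (2 * a)" using k \<open>0 < a\<close> by auto
    fix u v
    obtain z where z: "z \<in> k" "dist z u < a / 4" using k(2) by blast
    let ?t = "dist u z - dist v z"
    \<comment> \<open>Expanding this square and dividing by \<open>2 * a\<close> gives
      \<open>amgm\<close>. Its constant \<open>a / 2\<close> and twice the net radius
      \<open>a / 4\<close> add up to \<open>a\<close>.\<close>
    have "0 \<le> (\<bar>?t\<bar> - a)\<^sup>2" by simp
    then have amgm: "\<bar>?t\<bar> \<le> a / 2 + 1 / (2 * a) * ?t\<^sup>2"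
      using \<open>0 < a\<close> by (simp add: field_simps power2_eq_square)
    have "dist u v \<le> 2 * dist z u + \<bar>?t\<bar>"
      using dist_triangle2[of u v z] by (simp add: dist_commute)
    also have "\<dots> \<le> a + 1 / (2 * a) * ?t\<^sup>2" using z(2) amgm by linarith
    also have "?t\<^sup>2 \<le> (\<Sum>z\<in>k. (dist u z - dist v z)\<^sup>2)"
      using k(1) z(1) by (intro member_le_sum) auto
    finally show "dist u v \<le> a + 1 / (2 * a) * (\<Sum>z\<in>k. (dist u z - dist v z)\<^sup>2)"
      using \<open>0 < a\<close> by (simp add: divide_right_mono)
  qed
qed

theorem theorem2p14:
  fixes \<nu> :: "'g::{topological_ab_group_add, t2_space} measure"
    and F :: "nat \<Rightarrow> 'g set"
    and T :: "'g \<Rightarrow> 'x::metric_space \<Rightarrow> 'x"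
  assumes "locally_compact_space (euclidean :: 'g topology)"
    and "haar_measure \<nu>"
    and "folner_sequence \<nu> F"
    and "satisfies_pointwise_ergodic_theorem \<nu> F"
    and "G_TDS T"
  shows "mean_equicontinuous \<nu> F T \<longleftrightarrow>
    (\<forall>f :: 'x \<Rightarrow> complex. continuous_on UNIV f \<longrightarrow> f_mean_equicontinuous \<nu> F T f)"
proof -
  have compact: "compact (UNIV :: 'x set)"
    using assms(5) by (simp add: G_TDS_def)
  have orbit: "(\<lambda>j. T j x) \<in> borel_measurable \<nu>" for x
    using G_TDS_orbit_measurable assms(2,5) by (auto simp: haar_measure_def)
  have F: "F n \<in> sets \<nu>" "emeasure \<nu> (F n) < \<infinity>" "measure \<nu> (F n) > 0" for n
    using assms(3) by (auto simp: folner_sequence_def measure_def enn2real_positive_iff top.not_eq_extremum)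
  have int_bounded: "set_integrable \<nu> (F n) h"
    if "h \<in> borel_measurable \<nu>" "\<And>j. \<bar>h j\<bar> \<le> B" for n B and h :: "'g \<Rightarrow> real"
    unfolding set_integrable_def using F that
    by (intro integrableI_bounded_set_indicator[where B = B]) auto
  have int_dist: "set_integrable \<nu> (F n) (\<lambda>j. dist (T j x) (T j y))" for n x y
  proof -
    obtain e where "\<And>u v :: 'x. dist u v \<le> e"
      using compact_imp_bounded[OF compact] by (auto simp: bounded_two_points)
    with borel_measurable_dist_compact[OF compact orbit orbit] show ?thesis
      by (intro int_bounded[of _ e]) auto
  qed
  have int_sq: "set_integrable \<nu> (F n) (\<lambda>j. (cmod (f (T j x) - f (T j y)))\<^sup>2)"
    if f: "continuous_on UNIV f" for n x y and f :: "'x \<Rightarrow> complex"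
  proof -
    have [measurable]: "(\<lambda>j. f (T j x)) \<in> borel_measurable \<nu>" for x
      by (rule borel_measurable_continuous_on[OF f orbit])
    obtain B where B: "\<And>u. cmod (f u) \<le> B"
      using compact_imp_bounded[OF compact_continuous_image[OF f compact]]
      by (auto simp: bounded_pos)
    have "cmod (f u - f v) \<le> 2 * B" for u v
      using norm_triangle_ineq4[of "f u" "f v"] B[of u] B[of v] by linarith
    then have "(cmod (f u - f v))\<^sup>2 \<le> (2 * B)\<^sup>2" for u v
      by (intro power_mono) auto
    then show ?thesis
      by (intro int_bounded[of _ "(2 * B)\<^sup>2"]) simp_all
  qed
  show ?thesis
  proof (intro iffI allI impI)
    fix f :: "'x \<Rightarrow> complex"
    assume mean: "mean_equicontinuous \<nu> F T" and f: "continuous_on UNIV f"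
    show "f_mean_equicontinuous \<nu> F T f"
      unfolding f_mean_equicontinuous_def
    proof (intro allI impI)
      fix x and \<epsilon> :: real assume \<epsilon>: "0 < \<epsilon>"
      \<comment> \<open>Half of \<open>\<epsilon>\<^sup>2\<close> goes to the constant; the
        threshold \<open>\<epsilon>\<^sup>2 / (2 * b)\<close> below makes the linear term contribute
        the other half, and the square root returns \<open>\<epsilon>\<close>.\<close>
      obtain b where b: "0 < b"
          "\<And>u v. (cmod (f u - f v))\<^sup>2 \<le> \<epsilon>\<^sup>2 / 2 + b * dist u v"
        using uniformly_continuous_sq_le_affine_dist[OF compact f, of "\<epsilon>\<^sup>2 / 2"] \<epsilon> by auto
      obtain \<delta> where \<delta>: "0 < \<delta>" "\<And>y. dist x y \<le> \<delta> \<Longrightarrow> d_b \<nu> F T x y < ereal (\<epsilon>\<^sup>2 / (2 * b))"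
        using mean[unfolded mean_equicontinuous_def, rule_format, of "\<epsilon>\<^sup>2 / (2 * b)" x] \<epsilon> b(1)
        by auto
      have "d_f \<nu> F T f x y \<le> ereal \<epsilon>" if y: "dist x y \<le> \<delta>" for y
      proof -
        have "\<forall>\<^sub>F n in sequentially.
            folner_average \<nu> F n (\<lambda>j. dist (T j x) (T j y)) < \<epsilon>\<^sup>2 / (2 * b)"
          using Limsup_lessD[OF \<delta>(2)[OF y, unfolded d_b_def]] by simp
        then have "\<forall>\<^sub>F n in sequentially.
            ereal (sqrt (folner_average \<nu> F n (\<lambda>j. (cmod (f (T j x) - f (T j y)))\<^sup>2))) \<le> ereal \<epsilon>"
        proof eventually_elim
          case (elim n)
          have "folner_average \<nu> F n (\<lambda>j. (cmod (f (T j x) - f (T j y)))\<^sup>2)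
              \<le> \<epsilon>\<^sup>2 / 2 + b * folner_average \<nu> F n (\<lambda>j. dist (T j x) (T j y))"
            by (rule folner_average_mono_affine[OF F(3) int_sq[OF f] int_dist b(2)])
          also have "\<dots> \<le> \<epsilon>\<^sup>2" using elim b(1) by (simp add: field_simps)
          finally show ?case using \<epsilon> by (simp add: real_le_lsqrt)
        qed
        then show ?thesis unfolding d_f_def by (rule Limsup_bounded)
      qed
      with \<delta>(1) show "\<exists>\<delta>>0. \<forall>y. dist x y \<le> \<delta> \<longrightarrow> d_f \<nu> F T f x y \<le> ereal \<epsilon>" by blast
    qed
  next
    assume all: "\<forall>f :: 'x \<Rightarrow> complex. continuous_on UNIV f \<longrightarrow> f_mean_equicontinuous \<nu> F T f"
    show "mean_equicontinuous \<nu> F T"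
      unfolding mean_equicontinuous_def
    proof (intro allI impI)
      fix x and \<epsilon> :: real assume \<epsilon>: "0 < \<epsilon>"
      obtain k :: "'x set" and b where k: "finite k" and b: "0 < b"
          "\<And>u v. dist u v \<le> \<epsilon> / 4 + b * (\<Sum>z\<in>k. (dist u z - dist v z)\<^sup>2)"
        using dist_le_affine_sum_sq[OF compact, of "\<epsilon> / 4"] \<epsilon> by auto
      \<comment> \<open>The test functions are the distances to the net points; viewing them as
        complex-valued leaves the squared differences unchanged.\<close>
      define f where "f z u = complex_of_real (dist u z)" for z u :: 'x
      have f: "continuous_on UNIV (f z)" for z
        unfolding f_def by (intro continuous_intros)
      have f_sq: "(cmod (f z u - f z v))\<^sup>2 = (dist u z - dist v z)\<^sup>2" for z u v
        by (simp add: f_def flip: of_real_diff)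
      \<comment> \<open>Chosen so that \<open>card k\<close> averages below \<open>c\<close>,
        multiplied by \<open>b\<close>, contribute at most \<open>\<epsilon> / 4\<close>. The added
        1 keeps the denominator positive for empty \<open>k\<close>.\<close>
      define c where "c = \<epsilon> / (4 * b * (real (card k) + 1))"
      have c: "0 < c" using \<epsilon> b(1) by (simp add: c_def)
      \<comment> \<open>The hypothesis yields only a weak inequality; halving \<open>sqrt c\<close>
        makes the limsup strictly smaller than \<open>sqrt c\<close>, so the averages are eventually
        below \<open>c\<close>.\<close>
      have "\<forall>z. \<exists>\<delta>>0. \<forall>y. dist x y \<le> \<delta> \<longrightarrow> d_f \<nu> F T (f z) x y \<le> ereal (sqrt c / 2)"
        using all f c by (auto simp: f_mean_equicontinuous_def)
      then obtain \<delta> where \<delta>: "\<And>z. 0 < \<delta> z"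
          "\<And>z y. dist x y \<le> \<delta> z \<Longrightarrow> d_f \<nu> F T (f z) x y \<le> ereal (sqrt c / 2)"
        by metis
      \<comment> \<open>Inserting 1 ensures that the minimum is over a nonempty set of positive
        numbers.\<close>
      define \<delta>' where "\<delta>' = Min (insert 1 (\<delta> ` k))"
      have \<delta>': "0 < \<delta>'" "\<And>z. z \<in> k \<Longrightarrow> \<delta>' \<le> \<delta> z"
        using k \<delta>(1) by (auto simp: \<delta>'_def)
      have "d_b \<nu> F T x y < ereal \<epsilon>" if y: "dist x y \<le> \<delta>'" for y
      proof -
        let ?sq = "\<lambda>z j. (cmod (f z (T j x) - f z (T j y)))\<^sup>2"
        have "\<forall>\<^sub>F n in sequentially. folner_average \<nu> F n (?sq z) < c" if "z \<in> k" for z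
        proof -
          have "d_f \<nu> F T (f z) x y \<le> ereal (sqrt c / 2)"
            using y \<delta>'(2)[OF that] by (intro \<delta>(2)) simp
          also have "\<dots> < ereal (sqrt c)" using c by simp
          finally show ?thesis
            unfolding d_f_def by (drule_tac Limsup_lessD) simp
        qed
        \<comment> \<open>Finiteness of \<open>k\<close> allows one threshold in \<open>n\<close>
          for all test functions.\<close>
        then have "\<forall>\<^sub>F n in sequentially. \<forall>z\<in>k. folner_average \<nu> F n (?sq z) < c"
          using k by (simp add: eventually_ball_finite)
        then have "\<forall>\<^sub>F n in sequentially.
            ereal (folner_average \<nu> F n (\<lambda>j. dist (T j x) (T j y))) \<le> ereal (\<epsilon> / 2)"
        proof eventually_elim
          case (elim n)
          have int_sum: "set_integrable \<nu> (F n) (\<lambda>j. \<Sum>z\<in>k. ?sq z j)"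
            using int_sq[OF f] by (simp add: set_integrable_def sum_distrib_left)
          have "folner_average \<nu> F n (\<lambda>j. dist (T j x) (T j y))
              \<le> \<epsilon> / 4 + b * folner_average \<nu> F n (\<lambda>j. \<Sum>z\<in>k. ?sq z j)"
            using b(2) k int_sq[OF f] f_sq
            by (intro folner_average_mono_affine F int_dist int_sum) auto
          also have "\<dots> = \<epsilon> / 4 + b * (\<Sum>z\<in>k. folner_average \<nu> F n (?sq z))"
            by (simp add: folner_average_sum int_sq[OF f])
          also have "\<dots> \<le> \<epsilon> / 4 + b * (real (card k) * c)"
            using elim b(1) sum_bounded_above[of k "\<lambda>z. folner_average \<nu> F n (?sq z)" c]
            by (auto intro: less_imp_le)
          also have "b * (real (card k) * c) \<le> b * ((real (card k) + 1) * c)"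
            using b(1) c by (intro mult_left_mono mult_right_mono) auto
          also have "\<dots> = \<epsilon> / 4"
            using b(1) of_nat_0_le_iff[of "card k", where ?'a = real] by (simp add: c_def)
          finally show ?case by simp
        qed
        \<comment> \<open>Passing to the limsup preserves only weak bounds, so the estimate stops at
          \<open>\<epsilon> / 2\<close> to leave room for the strict inequality.\<close>
        then have "d_b \<nu> F T x y \<le> ereal (\<epsilon> / 2)"
          unfolding d_b_def by (rule Limsup_bounded)
        also have "\<dots> < ereal \<epsilon>" using \<epsilon> by simp
        finally show ?thesis .
      qed
      with \<delta>'(1) show "\<exists>\<delta>>0. \<forall>y. dist x y \<le> \<delta> \<longrightarrow> d_b \<nu> F T x y < ereal \<epsilon>" by blast
    qed
  qed
qed

end
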